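(* Let $(A,\ast)$ be a finite-dimensional Zinbiel algebra and $(B=\oplus_{i\in\mathbb Z}B_i,\diamond)$ a $\mathbb Z$-graded perm algebra. Define a binary operation on $A\otimes B$ by $$(a_1\otimes b_1)\cdot(a_2\otimes b_2)=(a_1\ast a_2)\otimes(b_1\diamond b_2)+(a_2\ast a_1)\otimes(b_2\diamond b_1).$$ Then $(A\otimes B,\cdot)$ is a $\mathbb Z$-graded commutative associative algebra. Moreover, let $(B=\oplus_{i\in\mathbb Z}B_i,\diamond)$ be the Laurent $\mathbb Z$-graded perm algebra $B^L$ described in the context, and let $A$ be a finite-dimensional vector space with a bilinear operation $\ast$. With $\cdot$ defined on $A\otimes B$ by the same formula, $(A\otimes B,\cdot)$ is a $\mathbb Z$-graded commutative associative algebra if and only if $(A,\ast)$ is a Zinbiel algebra.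
   Context: All vector spaces are over a field $\mathbf k$ of characteristic zero; algebras are not required to be unital. A Zinbiel algebra $(A,\ast)$: $a_1\ast(a_2\ast a_3)=(a_1\ast a_2)\ast a_3+(a_2\ast a_1)\ast a_3$. A perm algebra $(B,\diamond)$: $b_1\diamond(b_2\diamond b_3)=(b_1\diamond b_2)\diamond b_3=(b_2\diamond b_1)\diamond b_3$. A $\mathbb Z$-graded perm algebra (resp. commutative associative algebra) is such an algebra with a decomposition $B=\oplus_{i\in\mathbb Z}B_i$ where each $B_i$ is finite-dimensional and the product maps $B_i\times B_j$ into $B_{i+j}$. $A\otimes B$ is graded by the subspaces $A\otimes B_i$. Laurent $\mathbb Z$-graded perm algebra: $B^L=\{f_1\partial_1+f_2\partial_2\mid f_1,f_2\in\mathbf k[x_1^{\pm1},x_2^{\pm1}]\}$ with $(x_1^{i_1}x_2^{i_2}\partial_s)\diamond(x_1^{j_1}x_2^{j_2}\partial_t)=\delta_{s,1}x_1^{i_1+j_1+1}x_2^{i_2+j_2}\partial_t+\delta_{s,2}x_1^{i_1+j_1}x_2^{i_2+j_2+1}\partial_t$, regarded as $\mathbb Z$-graded by $B_i=\{f_1\partial_1+f_2\partial_2\mid f_1,f_2\text{ homogeneous of total degree }i-1\}$, $i\in\mathbb Z$.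
   Formalization: In the second claim (the Laurent case), "Z-graded" is taken without requiring finite-dimensional homogeneous components, because every component of B^L is infinite-dimensional and the claim would fail for every nonzero Zinbiel algebra A. *)

theory Defs
  imports Complex_Main
    "HOL-Library.Function_Algebras"
    "HOL-Library.Product_Plus"
    "HOL-Library.Poly_Mapping"
begin

section \<open>Algebras on a subspace of a vector space\<close>

text \<open>
  A vector space is given by its scalar multiplication \<open>s\<close>, as in \<open>HOL.Vector_Spaces\<close>; the
  underlying space of an algebra is a subspace \<open>V\<close> of it, because \<open>A \<otimes> B\<close> below is a proper
  subset of its type. Only values of the operation on \<open>V\<close> matter.
\<close>

definition fin_dim :: "('k::field \<Rightarrow> 'v::ab_group_add \<Rightarrow> 'v) \<Rightarrow> 'v set \<Rightarrow> bool" where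
  "fin_dim s V \<longleftrightarrow> (\<exists>S. finite S \<and> V = module.span s S)"

definition algebra_on ::
    "('k::field \<Rightarrow> 'v::ab_group_add \<Rightarrow> 'v) \<Rightarrow> 'v set \<Rightarrow> ('v \<Rightarrow> 'v \<Rightarrow> 'v) \<Rightarrow> bool" where
  "algebra_on s V m \<longleftrightarrow>
     vector_space s \<and> module.subspace s V \<and>
     (\<forall>x\<in>V. \<forall>y\<in>V. m x y \<in> V) \<and>
     (\<forall>x\<in>V. \<forall>y\<in>V. \<forall>z\<in>V. m (x + y) z = m x z + m y z \<and> m x (y + z) = m x y + m x z) \<and>
     (\<forall>c. \<forall>x\<in>V. \<forall>y\<in>V. m (s c x) y = s c (m x y) \<and> m x (s c y) = s c (m x y))"

definition zinbiel_algebra ::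
    "('k::field \<Rightarrow> 'v::ab_group_add \<Rightarrow> 'v) \<Rightarrow> 'v set \<Rightarrow> ('v \<Rightarrow> 'v \<Rightarrow> 'v) \<Rightarrow> bool" where
  "zinbiel_algebra s V m \<longleftrightarrow> algebra_on s V m \<and>
     (\<forall>x\<in>V. \<forall>y\<in>V. \<forall>z\<in>V. m x (m y z) = m (m x y) z + m (m y x) z)"

definition perm_algebra ::
    "('k::field \<Rightarrow> 'v::ab_group_add \<Rightarrow> 'v) \<Rightarrow> 'v set \<Rightarrow> ('v \<Rightarrow> 'v \<Rightarrow> 'v) \<Rightarrow> bool" where
  "perm_algebra s V m \<longleftrightarrow> algebra_on s V m \<and>
     (\<forall>x\<in>V. \<forall>y\<in>V. \<forall>z\<in>V. m x (m y z) = m (m x y) z \<and> m (m x y) z = m (m y x) z)"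

definition comm_assoc_algebra ::
    "('k::field \<Rightarrow> 'v::ab_group_add \<Rightarrow> 'v) \<Rightarrow> 'v set \<Rightarrow> ('v \<Rightarrow> 'v \<Rightarrow> 'v) \<Rightarrow> bool" where
  "comm_assoc_algebra s V m \<longleftrightarrow> algebra_on s V m \<and>
     (\<forall>x\<in>V. \<forall>y\<in>V. m x y = m y x) \<and>
     (\<forall>x\<in>V. \<forall>y\<in>V. \<forall>z\<in>V. m (m x y) z = m x (m y z))"

section \<open>Gradings by the integers\<close>

definition direct_sum_decomp ::
    "('k::field \<Rightarrow> 'v::ab_group_add \<Rightarrow> 'v) \<Rightarrow> 'v set \<Rightarrow> (int \<Rightarrow> 'v set) \<Rightarrow> bool" where
  "direct_sum_decomp s V G \<longleftrightarrow>
     (\<forall>i. module.subspace s (G i) \<and> G i \<subseteq> V) \<and>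
     (\<forall>v\<in>V. \<exists>!f. (\<forall>i. f i \<in> G i) \<and> finite {i. f i \<noteq> 0} \<and> v = (\<Sum>i\<in>{i. f i \<noteq> 0}. f i))"

definition grading ::
    "('k::field \<Rightarrow> 'v::ab_group_add \<Rightarrow> 'v) \<Rightarrow> 'v set \<Rightarrow> (int \<Rightarrow> 'v set) \<Rightarrow> ('v \<Rightarrow> 'v \<Rightarrow> 'v) \<Rightarrow> bool"
  where
  "grading s V G m \<longleftrightarrow> direct_sum_decomp s V G \<and>
     (\<forall>i j. \<forall>x\<in>G i. \<forall>y\<in>G j. m x y \<in> G (i + j))"

text \<open>
  Finite-dimensionality of the components is kept apart from \<open>grading\<close>, because the Laurent perm
  algebra satisfies everything except that (\<open>laurent_not_fin_dim\<close> below).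
\<close>

definition Z_graded_perm_algebra ::
    "('k::field \<Rightarrow> 'v::ab_group_add \<Rightarrow> 'v) \<Rightarrow> 'v set \<Rightarrow> (int \<Rightarrow> 'v set) \<Rightarrow> ('v \<Rightarrow> 'v \<Rightarrow> 'v) \<Rightarrow> bool"
  where
  "Z_graded_perm_algebra s V G m \<longleftrightarrow>
     perm_algebra s V m \<and> grading s V G m \<and> (\<forall>i. fin_dim s (G i))"

definition Z_graded_comm_assoc_algebra ::
    "('k::field \<Rightarrow> 'v::ab_group_add \<Rightarrow> 'v) \<Rightarrow> 'v set \<Rightarrow> (int \<Rightarrow> 'v set) \<Rightarrow> ('v \<Rightarrow> 'v \<Rightarrow> 'v) \<Rightarrow> bool"
  where
  "Z_graded_comm_assoc_algebra s V G m \<longleftrightarrow>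
     comm_assoc_algebra s V m \<and> grading s V G m \<and> (\<forall>i. fin_dim s (G i))"

section \<open>Tensor products\<close>

definition bilinear_map ::
    "('k::field \<Rightarrow> 'a::ab_group_add \<Rightarrow> 'a) \<Rightarrow> ('k \<Rightarrow> 'b::ab_group_add \<Rightarrow> 'b) \<Rightarrow>
     ('k \<Rightarrow> 'c::ab_group_add \<Rightarrow> 'c) \<Rightarrow> ('a \<Rightarrow> 'b \<Rightarrow> 'c) \<Rightarrow> bool" where
  "bilinear_map sA sB sC f \<longleftrightarrow>
     (\<forall>a. Vector_Spaces.linear sB sC (f a)) \<and> (\<forall>b. Vector_Spaces.linear sA sC (\<lambda>a. f a b))"

text \<open>
  \<open>A \<otimes> B\<close> is realised as the space of functionals on bilinear forms \<open>A \<times> B \<rightarrow> k\<close> spanned by the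
  evaluations \<open>a \<otimes> b : \<beta> \<mapsto> \<beta> a b\<close> (set to 0 off the bilinear forms). Over a field this has the
  universal property of the tensor product, which is proved as \<open>tensor_universal\<close> and
  \<open>tensor_universal_unique\<close>.
\<close>

type_synonym ('a, 'b, 'k) tensor = "('a \<Rightarrow> 'b \<Rightarrow> 'k) \<Rightarrow> 'k"

definition tensor_scale :: "'k::field \<Rightarrow> ('a, 'b, 'k) tensor \<Rightarrow> ('a, 'b, 'k) tensor" where
  "tensor_scale c x = (\<lambda>\<beta>. c * x \<beta>)"

definition pure_tensor ::
    "('k::field \<Rightarrow> 'a::ab_group_add \<Rightarrow> 'a) \<Rightarrow> ('k \<Rightarrow> 'b::ab_group_add \<Rightarrow> 'b) \<Rightarrow> 'a \<Rightarrow> 'b \<Rightarrow>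
     ('a, 'b, 'k) tensor" where
  "pure_tensor sA sB a b = (\<lambda>\<beta>. if bilinear_map sA sB (*) \<beta> then \<beta> a b else 0)"

text \<open>\<open>tensor_sub sA sB W\<close> is \<open>A \<otimes> W\<close> inside \<open>A \<otimes> B\<close>, for a subspace \<open>W\<close> of \<open>B\<close>.\<close>

definition tensor_sub ::
    "('k::field \<Rightarrow> 'a::ab_group_add \<Rightarrow> 'a) \<Rightarrow> ('k \<Rightarrow> 'b::ab_group_add \<Rightarrow> 'b) \<Rightarrow> 'b set \<Rightarrow>
     ('a, 'b, 'k) tensor set" where
  "tensor_sub sA sB W = module.span tensor_scale {pure_tensor sA sB a b | a b. b \<in> W}"

abbreviation tensor_space ::
    "('k::field \<Rightarrow> 'a::ab_group_add \<Rightarrow> 'a) \<Rightarrow> ('k \<Rightarrow> 'b::ab_group_add \<Rightarrow> 'b) \<Rightarrow>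
     ('a, 'b, 'k) tensor set" where
  "tensor_space sA sB \<equiv> tensor_sub sA sB UNIV"

definition tensor_op_spec ::
    "('k::field \<Rightarrow> 'a::ab_group_add \<Rightarrow> 'a) \<Rightarrow> ('k \<Rightarrow> 'b::ab_group_add \<Rightarrow> 'b) \<Rightarrow>
     ('a \<Rightarrow> 'a \<Rightarrow> 'a) \<Rightarrow> ('b \<Rightarrow> 'b \<Rightarrow> 'b) \<Rightarrow>
     (('a, 'b, 'k) tensor \<Rightarrow> ('a, 'b, 'k) tensor \<Rightarrow> ('a, 'b, 'k) tensor) \<Rightarrow> bool" where
  "tensor_op_spec sA sB star dia m \<longleftrightarrow>
     algebra_on tensor_scale (tensor_space sA sB) m \<and>
     (\<forall>a1 b1 a2 b2. m (pure_tensor sA sB a1 b1) (pure_tensor sA sB a2 b2) =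
        pure_tensor sA sB (star a1 a2) (dia b1 b2) + pure_tensor sA sB (star a2 a1) (dia b2 b1))"

text \<open>
  The bilinear operation \<open>(a1 \<otimes> b1) \<cdot> (a2 \<otimes> b2) = (a1 * a2) \<otimes> (b1 \<diamond> b2) + (a2 * a1) \<otimes> (b2 \<diamond> b1)\<close>:
  it exists when \<open>*\<close> and \<open>\<diamond>\<close> are bilinear, and is unique on \<open>A \<otimes> B\<close>
  (\<open>tensor_op_spec\<close>, \<open>tensor_op_unique\<close>).
\<close>

definition tensor_op ::
    "('k::field \<Rightarrow> 'a::ab_group_add \<Rightarrow> 'a) \<Rightarrow> ('k \<Rightarrow> 'b::ab_group_add \<Rightarrow> 'b) \<Rightarrow>
     ('a \<Rightarrow> 'a \<Rightarrow> 'a) \<Rightarrow> ('b \<Rightarrow> 'b \<Rightarrow> 'b) \<Rightarrow>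
     ('a, 'b, 'k) tensor \<Rightarrow> ('a, 'b, 'k) tensor \<Rightarrow> ('a, 'b, 'k) tensor" where
  "tensor_op sA sB star dia = (SOME m. tensor_op_spec sA sB star dia m)"

subsection \<open>Universal property\<close>

lemma vector_space_tensor_scale: "vector_space (tensor_scale :: 'k::field \<Rightarrow> ('a,'b,'k) tensor \<Rightarrow> _)"
  by unfold_locales (auto simp: tensor_scale_def plus_fun_def algebra_simps)

interpretation ts: vector_space "tensor_scale :: 'k::field \<Rightarrow> ('a,'b,'k) tensor \<Rightarrow> _"
  by (rule vector_space_tensor_scale)

lemma vector_space_mult: "vector_space ((*) :: 'k::field \<Rightarrow> 'k \<Rightarrow> 'k)"
  by unfold_locales (auto simp: algebra_simps)

lemma bilinear_map_iff:
  assumes "vector_space sA" "vector_space sB" "vector_space sC"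
  shows "bilinear_map sA sB sC f \<longleftrightarrow>
    (\<forall>a b b'. f a (b + b') = f a b + f a b') \<and> (\<forall>a c b. f a (sB c b) = sC c (f a b)) \<and>
    (\<forall>a a' b. f (a + a') b = f a b + f a' b) \<and> (\<forall>a c b. f (sA c a) b = sC c (f a b))"
  using assms by (auto simp: bilinear_map_def Vector_Spaces.linear_iff)

lemma pure_in_tensor_space: "pure_tensor sA sB a b \<in> tensor_space sA sB"
  unfolding tensor_sub_def by (rule ts.span_base) auto

lemma tensor_space_induct [consumes 1, case_names zero step]:
  assumes "x \<in> tensor_space sA sB"
    and "P 0" "\<And>c a b y. y \<in> tensor_space sA sB \<Longrightarrow> P y \<Longrightarrow> P (tensor_scale c (pure_tensor sA sB a b) + y)"
  shows "P x"
proof -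
  have "x \<in> tensor_space sA sB \<and> P x"
    using assms(1) unfolding tensor_sub_def
  proof (induction rule: ts.span_induct_alt)
    case base
    then show ?case using assms(2) ts.span_zero by blast
  next
    case (step c x y)
    from step(1) obtain a b where x: "x = pure_tensor sA sB a b" by auto
    show ?case
      using step(2) assms(3)[of y c a b] pure_in_tensor_space[of sA sB a b] unfolding x tensor_sub_def
      by (blast intro: ts.span_add ts.span_scale)
  qed
  then show ?thesis ..
qed

lemma pure_tensor_bilinear:
  assumes "vector_space sA" "vector_space sB"
  shows "bilinear_map sA sB tensor_scale (pure_tensor sA sB)"
  unfolding bilinear_map_iff[OF assms vector_space_tensor_scale]
  by (auto simp: pure_tensor_def tensor_scale_def fun_eq_iff bilinear_map_iff[OF assms vector_space_mult])

lemma ex_functional: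
  assumes "vector_space (sC :: 'k::field \<Rightarrow> 'c::ab_group_add \<Rightarrow> 'c)" "v \<noteq> 0"
  shows "\<exists>\<phi>. Vector_Spaces.linear sC (*) \<phi> \<and> \<phi> v \<noteq> 0"
proof -
  interpret vector_space_pair sC "(*) :: 'k \<Rightarrow> 'k \<Rightarrow> 'k"
    using assms(1) vector_space_mult by (simp add: vector_space_pair_def)
  have "vs1.independent {v}" using assms(2) by simp
  from linear_independent_extend[OF this, of "\<lambda>_. 1"] show ?thesis by (metis singletonI zero_neq_one)
qed

definition linear_on_tensor ::
    "('k::field \<Rightarrow> 'a::ab_group_add \<Rightarrow> 'a) \<Rightarrow> ('k \<Rightarrow> 'b::ab_group_add \<Rightarrow> 'b) \<Rightarrow>
     ('k \<Rightarrow> 'c::ab_group_add \<Rightarrow> 'c) \<Rightarrow> (('a, 'b, 'k) tensor \<Rightarrow> 'c) \<Rightarrow> bool" where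
  "linear_on_tensor sA sB sC g \<longleftrightarrow>
     (\<forall>x\<in>tensor_space sA sB. \<forall>y\<in>tensor_space sA sB. g (x + y) = g x + g y) \<and>
     (\<forall>c. \<forall>x\<in>tensor_space sA sB. g (tensor_scale c x) = sC c (g x))"

theorem tensor_universal:
  fixes f :: "'a::ab_group_add \<Rightarrow> 'b::ab_group_add \<Rightarrow> 'c::ab_group_add"
    and sA :: "'k::field \<Rightarrow> 'a \<Rightarrow> 'a"
  assumes A: "vector_space sA" and B: "vector_space sB" and C: "vector_space sC"
    and f: "bilinear_map sA sB sC f"
  shows "\<exists>g. linear_on_tensor sA sB sC g \<and> (\<forall>a b. g (pure_tensor sA sB a b) = f a b)"
proof -
  interpret C: vector_space sC by fact
  let ?T = "tensor_space sA sB"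
  let ?L = "\<lambda>\<phi>. Vector_Spaces.linear sC (*) \<phi>"
  have bil: "bilinear_map sA sB (*) (\<lambda>a b. \<phi> (f a b))" if "?L \<phi>" for \<phi>
    using f that C vector_space_mult
    by (simp add: bilinear_map_iff[OF A B C] bilinear_map_iff[OF A B vector_space_mult] Vector_Spaces.linear_iff)
  have ex: "\<exists>v. \<forall>\<phi>. ?L \<phi> \<longrightarrow> \<phi> v = x (\<lambda>a b. \<phi> (f a b))" if "x \<in> ?T" for x
    using that
  proof (induction rule: tensor_space_induct)
    case zero
    show ?case by (rule exI[of _ 0]) (auto dest: Vector_Spaces.linear.axioms(3) simp: module_hom.zero)
  next
    case (step c a b y)
    then obtain v where v: "\<forall>\<phi>. ?L \<phi> \<longrightarrow> \<phi> v = y (\<lambda>a b. \<phi> (f a b))" by blast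
    show ?case
      by (rule exI[of _ "sC c (f a b) + v"])
        (use v bil in \<open>auto simp: Vector_Spaces.linear_iff tensor_scale_def pure_tensor_def\<close>)
  qed
  have uniq: "v = w" if "\<forall>\<phi>. ?L \<phi> \<longrightarrow> \<phi> v = \<phi> w" for v w
  proof (rule ccontr)
    assume "v \<noteq> w"
    then obtain \<phi> where p: "?L \<phi>" "\<phi> (v - w) \<noteq> 0" using ex_functional[OF C, of "v - w"] by auto
    have "\<phi> (v - w) = \<phi> v - \<phi> w"
      using Vector_Spaces.linear.axioms(3)[OF p(1)] by (rule module_hom.diff)
    then show False using that p by simp
  qed
  define g where "g x = (SOME v. \<forall>\<phi>. ?L \<phi> \<longrightarrow> \<phi> v = x (\<lambda>a b. \<phi> (f a b)))" for x
  have g: "\<phi> (g x) = x (\<lambda>a b. \<phi> (f a b))" if "x \<in> ?T" "?L \<phi>" for x \<phi>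
    using someI_ex[OF ex[OF that(1)]] that(2) unfolding g_def by blast
  have T: "x + y \<in> ?T" "tensor_scale c x \<in> ?T" if "x \<in> ?T" "y \<in> ?T" for x y c
    using that by (auto simp: tensor_sub_def intro: ts.span_add ts.span_scale)
  show "\<exists>g. linear_on_tensor sA sB sC g \<and> (\<forall>a b. g (pure_tensor sA sB a b) = f a b)"
    unfolding linear_on_tensor_def
  proof (intro exI[of _ g] conjI ballI allI)
    fix x y assume xy: "x \<in> ?T" "y \<in> ?T"
    show "g (x + y) = g x + g y"
    proof (rule uniq, intro allI impI)
      fix \<phi> assume p: "?L \<phi>"
      then have "\<phi> (g x + g y) = \<phi> (g x) + \<phi> (g y)" by (simp add: Vector_Spaces.linear_iff)
      then show "\<phi> (g (x + y)) = \<phi> (g x + g y)" using g[OF _ p] T(1)[OF xy] xy by simp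
    qed
  next
    fix c x assume x: "x \<in> ?T"
    show "g (tensor_scale c x) = sC c (g x)"
    proof (rule uniq, intro allI impI)
      fix \<phi> assume p: "?L \<phi>"
      have "\<phi> (g (tensor_scale c x)) = c * x (\<lambda>a b. \<phi> (f a b))"
        unfolding g[OF T(2)[OF x x] p] by (simp only: tensor_scale_def)
      also have "\<dots> = c * \<phi> (g x)" by (simp only: g[OF x p])
      also have "\<dots> = \<phi> (sC c (g x))" using p by (simp add: Vector_Spaces.linear_iff)
      finally show "\<phi> (g (tensor_scale c x)) = \<phi> (sC c (g x))" .
    qed
  next
    fix a b
    show "g (pure_tensor sA sB a b) = f a b"
      by (rule uniq) (auto simp: g pure_in_tensor_space, simp add: pure_tensor_def bil)
  qed
qed

theorem tensor_universal_unique: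
  assumes g: "linear_on_tensor sA sB sC g" and g': "linear_on_tensor sA sB sC g'"
    and eq: "\<And>a b. g (pure_tensor sA sB a b) = g' (pure_tensor sA sB a b)"
    and x: "x \<in> tensor_space sA sB"
  shows "g x = g' x"
proof -
  let ?T = "tensor_space sA sB"
  have z: "0 \<in> ?T" by (simp add: tensor_sub_def ts.span_zero)
  have add: "h (u + v) = h u + h v" and sc: "h (tensor_scale c u) = sC c (h u)"
    if "linear_on_tensor sA sB sC h" "u \<in> ?T" "v \<in> ?T" for h u v c
    using that unfolding linear_on_tensor_def by blast+
  show ?thesis
  proof (rule tensor_space_induct[where P = "\<lambda>x. g x = g' x", OF x])
    show "g 0 = g' 0" using add[OF g z z] add[OF g' z z] by simp
  next
    fix c a b y assume y: "y \<in> ?T" "g y = g' y"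
    have p: "pure_tensor sA sB a b \<in> ?T" by (rule pure_in_tensor_space)
    then have cp: "tensor_scale c (pure_tensor sA sB a b) \<in> ?T"
      unfolding tensor_sub_def by (rule ts.span_scale)
    show "g (tensor_scale c (pure_tensor sA sB a b) + y) = g' (tensor_scale c (pure_tensor sA sB a b) + y)"
      using y(2) by (simp only: add[OF g cp y(1)] add[OF g' cp y(1)] sc[OF g p p] sc[OF g' p p] eq)
  qed
qed

lemma tensor_op_spec_ex:
  fixes sA :: "'k::field \<Rightarrow> 'a::ab_group_add \<Rightarrow> 'a" and sB :: "'k \<Rightarrow> 'b::ab_group_add \<Rightarrow> 'b"
  assumes "algebra_on sA UNIV star" "algebra_on sB UNIV dia"
  shows "\<exists>m. tensor_op_spec sA sB star dia m"
proof -
  let ?T = "tensor_space sA sB"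
  have A: "vector_space sA" and B: "vector_space sB"
    using assms by (auto simp: algebra_on_def)
  note bl = bilinear_map_iff[OF A B vector_space_mult]
  define F where "F \<beta> a1 b1 = (\<lambda>a2 b2. \<beta> (star a1 a2) (dia b1 b2) + \<beta> (star a2 a1) (dia b2 b1))"
    for \<beta> :: "'a \<Rightarrow> 'b \<Rightarrow> 'k" and a1 b1
  define m where "m x y = (\<lambda>\<beta>. if bilinear_map sA sB (*) \<beta> then x (\<lambda>a1 b1. y (F \<beta> a1 b1)) else 0)"
    for x y :: "('a,'b,'k) tensor"
  have st: "star (u + v) w = star u w + star v w" "star u (v + w) = star u v + star u w"
    "star (sA c u) v = sA c (star u v)" "star u (sA c v) = sA c (star u v)" for u v w c
    using assms(1) by (auto simp: algebra_on_def)
  have di: "dia (u + v) w = dia u w + dia v w" "dia u (v + w) = dia u v + dia u w"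
    "dia (sB c u) v = sB c (dia u v)" "dia u (sB c v) = sB c (dia u v)" for u v w c
    using assms(2) by (auto simp: algebra_on_def)
  have bF: "bilinear_map sA sB (*) (F \<beta> a b)" if "bilinear_map sA sB (*) \<beta>" for \<beta> a b
    using that by (simp add: bl F_def st di algebra_simps)
  have lin: "x (\<lambda>a b. \<beta> a b + \<gamma> a b) = x \<beta> + x \<gamma> \<and> x (\<lambda>a b. c * \<beta> a b) = c * x \<beta>"
    if "x \<in> ?T" "bilinear_map sA sB (*) \<beta>" "bilinear_map sA sB (*) \<gamma>" for x \<beta> \<gamma> c
    using that(1)
  proof (induction rule: tensor_space_induct)
    case (step d a b y)
    have "bilinear_map sA sB (*) (\<lambda>a b. \<beta> a b + \<gamma> a b)" "bilinear_map sA sB (*) (\<lambda>a b. c * \<beta> a b)"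
      using that(2,3) by (simp_all add: bl algebra_simps)
    with step that(2,3) show ?case by (simp add: tensor_scale_def pure_tensor_def algebra_simps)
  qed simp
  have by': "bilinear_map sA sB (*) (\<lambda>a b. y (F \<beta> a b))" if "y \<in> ?T" "bilinear_map sA sB (*) \<beta>" for y \<beta>
  proof -
    have "F \<beta> a (b + b') = (\<lambda>u v. F \<beta> a b u v + F \<beta> a b' u v)"
         "F \<beta> (a + a') b = (\<lambda>u v. F \<beta> a b u v + F \<beta> a' b u v)"
         "F \<beta> a (sB c b) = (\<lambda>u v. c * F \<beta> a b u v)"
         "F \<beta> (sA c a) b = (\<lambda>u v. c * F \<beta> a b u v)" for a a' b b' c
      using that(2) by (auto simp: bl F_def st di algebra_simps fun_eq_iff)
    then show ?thesis using lin[OF that(1) bF[OF that(2)] bF[OF that(2)]] by (simp add: bl)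
  qed
  have pp: "m (pure_tensor sA sB a1 b1) (pure_tensor sA sB a2 b2) =
        pure_tensor sA sB (star a1 a2) (dia b1 b2) + pure_tensor sA sB (star a2 a1) (dia b2 b1)"
    for a1 b1 a2 b2
  proof
    fix \<beta>
    show "m (pure_tensor sA sB a1 b1) (pure_tensor sA sB a2 b2) \<beta> =
        (pure_tensor sA sB (star a1 a2) (dia b1 b2) + pure_tensor sA sB (star a2 a1) (dia b2 b1)) \<beta>"
    proof (cases "bilinear_map sA sB (*) \<beta>")
      case True
      have "m (pure_tensor sA sB a1 b1) (pure_tensor sA sB a2 b2) \<beta> = pure_tensor sA sB a2 b2 (F \<beta> a1 b1)"
        using by'[OF pure_in_tensor_space True, of a2 b2] True by (simp add: m_def pure_tensor_def)
      then show ?thesis using True bF[OF True] by (simp add: pure_tensor_def F_def)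
    qed (simp add: m_def pure_tensor_def)
  qed
  have l1: "m (x + y) z = m x z + m y z" "m (tensor_scale c x) y = tensor_scale c (m x y)" for x y z c
    by (auto simp: m_def tensor_scale_def fun_eq_iff)
  have l2: "m x (y + z) = m x y + m x z" if "x \<in> ?T" "y \<in> ?T" "z \<in> ?T" for x y z
  proof
    fix \<beta> show "m x (y + z) \<beta> = (m x y + m x z) \<beta>"
      using lin[OF that(1) by'[OF that(2)] by'[OF that(3)], of \<beta> \<beta>] by (simp add: m_def)
  qed
  have l3: "m x (tensor_scale c y) = tensor_scale c (m x y)" if "x \<in> ?T" "y \<in> ?T" for x y c
  proof
    fix \<beta> show "m x (tensor_scale c y) \<beta> = tensor_scale c (m x y) \<beta>"
      using lin[OF that(1) by'[OF that(2)] by'[OF that(2)], of \<beta> \<beta> c] by (simp add: m_def tensor_scale_def)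
  qed
  have T: "x + y \<in> ?T" "tensor_scale c x \<in> ?T" "0 \<in> ?T" if "x \<in> ?T" "y \<in> ?T" for x y c
    using that by (auto simp: tensor_sub_def intro: ts.span_add ts.span_scale ts.span_zero)
  have Z: "0 \<in> ?T" by (simp add: tensor_sub_def ts.span_zero)
  have cl1: "m (pure_tensor sA sB a b) y \<in> ?T" if "y \<in> ?T" for a b y
    using that
  proof (induction rule: tensor_space_induct)
    case zero
    have "m (pure_tensor sA sB a b) 0 = 0"
      using l3[OF pure_in_tensor_space Z, of a b 0] by (simp add: tensor_scale_def zero_fun_def)
    then show ?case using Z by (simp del: zero_fun_apply)
  next
    case (step c a' b' y)
    then show ?case
      by (simp add: l2 l3 T[OF _ Z] pure_in_tensor_space pp del: plus_fun_apply) (intro T pure_in_tensor_space)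
  qed
  have cl: "m x y \<in> ?T" if "x \<in> ?T" "y \<in> ?T" for x y
    using that(1)
  proof (induction rule: tensor_space_induct)
    case zero
    have "m 0 y = 0" using l1(2)[of 0 0 y] by (simp add: tensor_scale_def zero_fun_def)
    then show ?case using Z by (simp del: zero_fun_apply)
  next
    case (step c a b z)
    then show ?case using that(2) by (simp add: l1 T cl1 del: plus_fun_apply)
  qed
  show ?thesis
  proof (rule exI)
    show "tensor_op_spec sA sB star dia m"
      unfolding tensor_op_spec_def algebra_on_def
      using pp l1 l2 l3 cl vector_space_tensor_scale by (auto simp: tensor_sub_def)
  qed
qed

theorem tensor_op_spec:
  assumes "algebra_on sA UNIV star" "algebra_on sB UNIV dia"
  shows "tensor_op_spec sA sB star dia (tensor_op sA sB star dia)"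
  unfolding tensor_op_def by (rule someI_ex[OF tensor_op_spec_ex[OF assms]])

theorem tensor_op_unique:
  assumes m: "tensor_op_spec sA sB star dia m" and m': "tensor_op_spec sA sB star dia m'"
    and x: "x \<in> tensor_space sA sB" and y: "y \<in> tensor_space sA sB"
  shows "m x y = m' x y"
proof -
  let ?T = "tensor_space sA sB"
  have Z: "0 \<in> ?T" by (simp add: tensor_sub_def ts.span_zero)
  have T: "tensor_scale c x \<in> ?T" if "x \<in> ?T" for x c
    using that by (auto simp: tensor_sub_def intro: ts.span_scale)
  have z: "n 0 y = 0" "n y 0 = 0" if "tensor_op_spec sA sB star dia n" "y \<in> ?T" for n y
  proof -
    have "n (0 + 0) y = n 0 y + n 0 y" "n y (0 + 0) = n y 0 + n y 0"
      using that Z unfolding tensor_op_spec_def algebra_on_def by blast+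
    then show "n 0 y = 0" "n y 0 = 0" by simp_all
  qed
  have 1: "m (pure_tensor sA sB a b) y = m' (pure_tensor sA sB a b) y" if "y \<in> ?T" for a b y
    using that
  proof (induction rule: tensor_space_induct)
    case (step c a' b' y)
    then show ?case using m m' unfolding tensor_op_spec_def algebra_on_def
      by (simp add: T pure_in_tensor_space del: plus_fun_apply)
  qed (simp add: z[OF m] z[OF m'] pure_in_tensor_space del: zero_fun_apply)
  from x show ?thesis
  proof (induction rule: tensor_space_induct)
    case (step c a b z)
    then show ?case using m m' 1[OF y] y unfolding tensor_op_spec_def algebra_on_def
      by (simp add: T pure_in_tensor_space del: plus_fun_apply)
  qed (simp add: z[OF m] z[OF m'] y del: zero_fun_apply)
qed

section \<open>The Laurent perm algebra\<close>

text \<open>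
  \<open>(int \<times> int) \<Rightarrow>\<^sub>0 'k\<close> with convolution is the ring of Laurent polynomials in \<open>x1, x2\<close>, the monomial
  \<open>x1^i x2^j\<close> being \<open>single (i, j) 1\<close>; the pair \<open>(f1, f2)\<close> stands for \<open>f1 \<partial>1 + f2 \<partial>2\<close>.
\<close>

type_synonym 'k laurent2 = "(int \<times> int) \<Rightarrow>\<^sub>0 'k"

type_synonym 'k laurent_der = "'k laurent2 \<times> 'k laurent2"

definition laurent_scale :: "'k::field \<Rightarrow> 'k laurent_der \<Rightarrow> 'k laurent_der" where
  "laurent_scale c f = (Poly_Mapping.single 0 c * fst f, Poly_Mapping.single 0 c * snd f)"

text \<open>
  Bilinear extension of the product on monomials: \<open>x^i \<partial>s \<diamond> x^j \<partial>t = x^(i+j) x\<^sub>s \<partial>t\<close>, hence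
  \<open>(f1 \<partial>1 + f2 \<partial>2) \<diamond> (g1 \<partial>1 + g2 \<partial>2) = (x1 f1 + x2 f2) (g1 \<partial>1 + g2 \<partial>2)\<close>; see
  \<open>laurent_mult_monom\<close>.
\<close>

definition laurent_mult :: "'k::field laurent_der \<Rightarrow> 'k laurent_der \<Rightarrow> 'k laurent_der" where
  "laurent_mult f g =
     (let u = Poly_Mapping.single (1, 0) 1 * fst f + Poly_Mapping.single (0, 1) 1 * snd f
      in (u * fst g, u * snd g))"

definition laurent_component :: "int \<Rightarrow> 'k::field laurent_der set" where
  "laurent_component i =
     {(f1, f2). \<forall>(p, q) \<in> Poly_Mapping.keys f1 \<union> Poly_Mapping.keys f2. p + q = i - 1}"

text \<open>\<open>laurent_monom i1 i2 s\<close> is \<open>x1^i1 x2^i2 \<partial>s\<close> for \<open>s \<in> {1, 2}\<close>.\<close>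

definition laurent_monom :: "int \<Rightarrow> int \<Rightarrow> nat \<Rightarrow> 'k::field laurent_der" where
  "laurent_monom i1 i2 s =
     (if s = 1 then (Poly_Mapping.single (i1, i2) 1, 0) else (0, Poly_Mapping.single (i1, i2) 1))"

theorem laurent_mult_monom:
  assumes "s \<in> {1, 2}" "t \<in> {1, 2}"
  shows "laurent_mult (laurent_monom i1 i2 s) (laurent_monom j1 j2 t) =
    laurent_scale (if s = 1 then 1 else 0) (laurent_monom (i1 + j1 + 1) (i2 + j2) t) +
    laurent_scale (if s = 2 then 1 else 0) (laurent_monom (i1 + j1) (i2 + j2 + 1) t)"
  using assms
  by (auto simp: laurent_mult_def laurent_monom_def laurent_scale_def mult_single Let_def algebra_simps
      zero_prod_def[symmetric])

lemma vector_space_laurent: "vector_space (laurent_scale :: 'k::field \<Rightarrow> _)"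
  by unfold_locales
    (auto simp: laurent_scale_def algebra_simps single_add mult_single mult.assoc[symmetric])

theorem laurent_perm_algebra: "perm_algebra laurent_scale UNIV (laurent_mult :: 'k::field laurent_der \<Rightarrow> _)"
proof -
  interpret vector_space "laurent_scale :: 'k \<Rightarrow> _" by (rule vector_space_laurent)
  show ?thesis
    unfolding perm_algebra_def algebra_on_def
    by (auto simp: vector_space_laurent laurent_mult_def laurent_scale_def Let_def algebra_simps)
qed

lemma lookup_single0_mult: "Poly_Mapping.lookup (Poly_Mapping.single 0 c * p) k = c * Poly_Mapping.lookup p k"
  for p :: "'k::field laurent2"
  by (simp add: mult_map_scale_conv_mult[symmetric] Poly_Mapping.map.rep_eq when_def)

lemma laurent_component_alt:
  "f \<in> laurent_component i \<longleftrightarrow>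
    (\<forall>p q. p + q \<noteq> i - 1 \<longrightarrow> Poly_Mapping.lookup (fst f) (p, q) = 0 \<and> Poly_Mapping.lookup (snd f) (p, q) = 0)"
  by (cases f) (auto simp: laurent_component_def in_keys_iff)

definition laurent_part :: "int \<Rightarrow> 'k::field laurent2 \<Rightarrow> 'k laurent2" where
  "laurent_part d p = (\<Sum>k\<in>{k\<in>Poly_Mapping.keys p. fst k + snd k = d}. Poly_Mapping.single k (Poly_Mapping.lookup p k))"

lemma lookup_laurent_part:
  "Poly_Mapping.lookup (laurent_part d p) k = (if fst k + snd k = d then Poly_Mapping.lookup p k else 0)"
  by (auto simp: laurent_part_def lookup_sum lookup_single when_def sum.delta' in_keys_iff)

lemma lookup_fst_sum: "Poly_Mapping.lookup (fst (sum f I)) k = (\<Sum>i\<in>I. Poly_Mapping.lookup (fst (f i)) k)"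
  by (simp add: fst_sum lookup_sum)

lemma lookup_snd_sum: "Poly_Mapping.lookup (snd (sum f I)) k = (\<Sum>i\<in>I. Poly_Mapping.lookup (snd (f i)) k)"
  by (simp add: snd_sum lookup_sum)

lemma laurent_eqI:
  fixes f g :: "'k::field laurent_der"
  assumes "\<And>p q. Poly_Mapping.lookup (fst f) (p, q) = Poly_Mapping.lookup (fst g) (p, q)"
    and "\<And>p q. Poly_Mapping.lookup (snd f) (p, q) = Poly_Mapping.lookup (snd g) (p, q)"
  shows "f = g"
  using assms by (auto simp: prod_eq_iff intro!: poly_mapping_eqI)

lemma laurent_keys_mult:
  fixes f g :: "'k::field laurent2"
  assumes "\<forall>(p, q)\<in>Poly_Mapping.keys f. p + q = d" "\<forall>(p, q)\<in>Poly_Mapping.keys g. p + q = e"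
  shows "\<forall>(p, q)\<in>Poly_Mapping.keys (f * g). p + q = d + e"
  using assms keys_mult[of f g] by fastforce

lemma laurent_keys_add:
  fixes f g :: "'k::field laurent2"
  assumes "\<forall>(p, q)\<in>Poly_Mapping.keys f. p + q = d" "\<forall>(p, q)\<in>Poly_Mapping.keys g. p + q = d"
  shows "\<forall>(p, q)\<in>Poly_Mapping.keys (f + g). p + q = d"
  using assms Poly_Mapping.keys_add[of f g] by fastforce

lemma subspace_laurent_component:
  "module.subspace laurent_scale (laurent_component i :: 'k::field laurent_der set)"
proof -
  interpret vector_space "laurent_scale :: 'k \<Rightarrow> _" by (rule vector_space_laurent)
  show ?thesis
    by (auto simp: subspace_def laurent_component_alt lookup_add laurent_scale_def lookup_single0_mult)
qed

lemma laurent_mult_component: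
  fixes f g :: "'k::field laurent_der"
  assumes "f \<in> laurent_component i" "g \<in> laurent_component j"
  shows "laurent_mult f g \<in> laurent_component (i + j)"
proof -
  let ?h = "\<lambda>(d :: int) p. \<forall>(a, b)\<in>Poly_Mapping.keys p. a + b = d"
  have f: "?h (i - 1) (fst f)" "?h (i - 1) (snd f)" and g: "?h (j - 1) (fst g)" "?h (j - 1) (snd g)"
    using assms by (auto simp: laurent_component_def)
  have x: "?h 1 (Poly_Mapping.single (1, 0) (1 :: 'k))" "?h 1 (Poly_Mapping.single (0, 1) (1 :: 'k))"
    by (auto split: if_splits)
  note u = laurent_keys_add[OF laurent_keys_mult[OF x(1) f(1)] laurent_keys_mult[OF x(2) f(2)]]
  from laurent_keys_mult[OF u g(1)] laurent_keys_mult[OF u g(2)] show ?thesis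
    by (auto simp: laurent_mult_def laurent_component_def Let_def)
qed

theorem laurent_grading: "grading laurent_scale UNIV laurent_component (laurent_mult :: 'k::field laurent_der \<Rightarrow> _)"
proof -
  let ?P = "\<lambda>(v :: 'k laurent_der) f. (\<forall>i. f i \<in> laurent_component i) \<and> finite {i. f i \<noteq> 0} \<and>
      v = (\<Sum>i\<in>{i. f i \<noteq> 0}. f i)"
  have lk: "Poly_Mapping.lookup (fst v) (p, q) = Poly_Mapping.lookup (fst (f (p + q + 1))) (p, q) \<and>
     Poly_Mapping.lookup (snd v) (p, q) = Poly_Mapping.lookup (snd (f (p + q + 1))) (p, q)"
    if f: "\<forall>i. f i \<in> laurent_component i" "finite I" "{i. f i \<noteq> 0} \<subseteq> I" and v: "v = (\<Sum>i\<in>I. f i)"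
    for v f p q I
  proof -
    have 0: "Poly_Mapping.lookup (fst (f i)) (p, q) = (if i = p + q + 1 then Poly_Mapping.lookup (fst (f (p + q + 1))) (p, q) else 0)"
      "Poly_Mapping.lookup (snd (f i)) (p, q) = (if i = p + q + 1 then Poly_Mapping.lookup (snd (f (p + q + 1))) (p, q) else 0)"
      for i using f(1) by (auto simp: laurent_component_alt)
    have 1: "f (p + q + 1) = 0" if "p + q + 1 \<notin> I" using that f(3) by blast
    show ?thesis
      unfolding v lookup_fst_sum lookup_snd_sum
      by (subst (1) 0(1), subst (1) 0(2)) (use f(2) 1 in \<open>auto simp: sum.delta\<close>)
  qed
  have ex: "\<exists>!f. ?P v f" for v
  proof -
    define f where "f i = (laurent_part (i - 1) (fst v), laurent_part (i - 1) (snd v))" for i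
    define I where "I = (\<lambda>(p, q). p + q + 1) ` (Poly_Mapping.keys (fst v) \<union> Poly_Mapping.keys (snd v))"
    have fc: "\<forall>i. f i \<in> laurent_component i"
      by (auto simp: laurent_component_alt f_def lookup_laurent_part)
    have "f i = 0" if "i \<notin> I" for i
      using that by (intro laurent_eqI) (force simp: f_def lookup_laurent_part I_def in_keys_iff)+
    then have fI: "{i. f i \<noteq> 0} \<subseteq> I" by auto
    have fin: "finite {i. f i \<noteq> 0}" by (rule finite_subset[OF fI]) (simp add: I_def)
    have sum: "v = (\<Sum>i\<in>{i. f i \<noteq> 0}. f i)"
      using lk[OF fc fin subset_refl refl] by (intro laurent_eqI) (simp_all add: f_def lookup_laurent_part)
    show ?thesis
    proof (rule ex1I[of _ f])
      show "?P v f" using fc fin sum by blast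
      fix g assume g: "?P v g"
      show "g = f"
      proof
        fix i show "g i = f i"
        proof (rule laurent_eqI)
          fix p q
          show "Poly_Mapping.lookup (fst (g i)) (p, q) = Poly_Mapping.lookup (fst (f i)) (p, q)"
            using lk[of g "{i. g i \<noteq> 0}" v p q] lk[OF fc fin subset_refl sum, of p q] g fc
            by (cases "p + q = i - 1") (auto simp: laurent_component_alt)
          show "Poly_Mapping.lookup (snd (g i)) (p, q) = Poly_Mapping.lookup (snd (f i)) (p, q)"
            using lk[of g "{i. g i \<noteq> 0}" v p q] lk[OF fc fin subset_refl sum, of p q] g fc
            by (cases "p + q = i - 1") (auto simp: laurent_component_alt)
        qed
      qed
    qed
  qed
  show ?thesis
    unfolding grading_def direct_sum_decomp_def
    using ex subspace_laurent_component laurent_mult_component by (intro conjI allI ballI) auto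
qed

theorem laurent_not_fin_dim: "\<not> fin_dim laurent_scale (laurent_component i :: 'k::field laurent_der set)"
proof
  interpret vector_space "laurent_scale :: 'k \<Rightarrow> _" by (rule vector_space_laurent)
  assume "fin_dim laurent_scale (laurent_component i :: 'k laurent_der set)"
  then obtain S :: "'k laurent_der set" where S: "finite S" "laurent_component i = span S"
    by (auto simp: fin_dim_def)
  define K where "K = (\<Union>f\<in>S. Poly_Mapping.keys (fst f))"
  have "finite K" using S(1) by (auto simp: K_def)
  then obtain a where a: "a \<notin> fst ` K" using ex_new_if_finite[of "fst ` K"] infinite_UNIV_int by blast
  have "subspace {f :: 'k laurent_der. Poly_Mapping.lookup (fst f) (a, i - 1 - a) = 0}"
    by (auto simp: subspace_def lookup_add laurent_scale_def lookup_single0_mult)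
  moreover have "S \<subseteq> {f. Poly_Mapping.lookup (fst f) (a, i - 1 - a) = 0}"
    using a by (force simp: K_def in_keys_iff image_iff)
  ultimately have "span S \<subseteq> {f. Poly_Mapping.lookup (fst f) (a, i - 1 - a) = 0}" by (rule span_minimal[rotated])
  moreover have "laurent_monom a (i - 1 - a) 1 \<in> (laurent_component i :: 'k laurent_der set)"
    by (simp add: laurent_monom_def laurent_component_def)
  ultimately show False using S(2) by (auto simp: laurent_monom_def)
qed

end

theory Submission
  imports Defs
begin

text \<open>
  In a perm algebra a triple product depends only on its last factor, so the associator of three
  pure tensors is a combination of three terms \<open>u\<^sub>i \<otimes> e\<^sub>i\<close>, where \<open>e\<^sub>i\<close> is the product of the
  \<open>b\<close>'s ending in \<open>b\<^sub>i\<close>, and the Zinbiel identity makes each \<open>u\<^sub>i\<close> vanish. The grading on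
  \<open>A \<otimes> B\<close> comes from the operators \<open>id \<otimes> p\<^sub>i\<close>, where \<open>p\<^sub>i\<close> projects \<open>B\<close> onto \<open>B\<^sub>i\<close>.
  Conversely, for \<open>b\<^sub>1 = b\<^sub>2 = \<partial>\<^sub>1\<close> and \<open>b\<^sub>3 = \<partial>\<^sub>2\<close> in the Laurent perm algebra, \<open>e\<^sub>3 = x\<^sub>1\<^sup>2 \<partial>\<^sub>2\<close> is
  independent of \<open>e\<^sub>1 = e\<^sub>2 = x\<^sub>1 x\<^sub>2 \<partial>\<^sub>1\<close>, and the vanishing of the \<open>e\<^sub>3\<close>-coefficient of the
  associator is the Zinbiel identity.
\<close>

section \<open>The operation on pure tensors and its commutativity\<close>

lemma algebra_onD:
  assumes "algebra_on s V m" "x \<in> V" "y \<in> V"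
  shows "m x y \<in> V"
    and "z \<in> V \<Longrightarrow> m (x + y) z = m x z + m y z"
    and "z \<in> V \<Longrightarrow> m z (x + y) = m z x + m z y"
    and "m (s c x) y = s c (m x y)" and "m x (s c y) = s c (m x y)"
  using assms by (auto simp: algebra_on_def)

lemma pure_in_tensor_sub: "b \<in> W \<Longrightarrow> pure_tensor sA sB a b \<in> tensor_sub sA sB W"
  unfolding tensor_sub_def by (rule ts.span_base) blast

lemma subspace_tensor_sub: "ts.subspace (tensor_sub sA sB W)"
  unfolding tensor_sub_def by (rule ts.subspace_span)

lemma tensor_sub_le_space: "tensor_sub sA sB W \<subseteq> tensor_space sA sB"
  unfolding tensor_sub_def by (rule ts.span_mono) blast

text \<open>Serves as an induction rule: properties that cut out a subspace \<open>S\<close> need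
  checking on pure tensors only.\<close>

lemma tensor_sub_subset:
  assumes "ts.subspace S" "\<And>a b. b \<in> W \<Longrightarrow> pure_tensor sA sB a b \<in> S"
  shows "tensor_sub sA sB W \<subseteq> S"
  unfolding tensor_sub_def using assms by (intro ts.span_minimal) auto

lemma tensor_op_pure:
  assumes "algebra_on sA UNIV star" "algebra_on sB UNIV dia"
  shows "tensor_op sA sB star dia (pure_tensor sA sB a1 b1) (pure_tensor sA sB a2 b2) =
    pure_tensor sA sB (star a1 a2) (dia b1 b2) + pure_tensor sA sB (star a2 a1) (dia b2 b1)"
  using tensor_op_spec[OF assms] by (simp add: tensor_op_spec_def)

lemma tensor_op_algebra:
  assumes "algebra_on sA UNIV star" "algebra_on sB UNIV dia"
  shows "algebra_on tensor_scale (tensor_space sA sB) (tensor_op sA sB star dia)"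
  using tensor_op_spec[OF assms] by (simp add: tensor_op_spec_def)

text \<open>The defining formula is symmetric in its two factors, so the opposite operation meets
  the same specification, and uniqueness identifies the two.\<close>

lemma tensor_op_commute:
  assumes "algebra_on sA UNIV star" "algebra_on sB UNIV dia"
    and "x \<in> tensor_space sA sB" "y \<in> tensor_space sA sB"
  shows "tensor_op sA sB star dia x y = tensor_op sA sB star dia y x"
proof -
  have "tensor_op_spec sA sB star dia (\<lambda>x y. tensor_op sA sB star dia y x)"
    using tensor_op_spec[OF assms(1,2)]
    by (auto simp: tensor_op_spec_def algebra_on_def add.commute)
  from tensor_op_unique[OF tensor_op_spec[OF assms(1,2)] this assms(3,4)] show ?thesis .
qed

section \<open>Associativity of the operation\<close>

text \<open>Both sides are linear in each argument, so the identity spreads from pure tensors to all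
  of A \<otimes> B one argument at a time, from the last to the first.\<close>

lemma tensor_assocI:
  assumes m: "algebra_on tensor_scale (tensor_space sA sB) m"
    and pure: "\<And>a1 b1 a2 b2 a3 b3.
      m (m (pure_tensor sA sB a1 b1) (pure_tensor sA sB a2 b2)) (pure_tensor sA sB a3 b3) =
      m (pure_tensor sA sB a1 b1) (m (pure_tensor sA sB a2 b2) (pure_tensor sA sB a3 b3))"
    and x: "x \<in> tensor_space sA sB" and y: "y \<in> tensor_space sA sB" and z: "z \<in> tensor_space sA sB"
  shows "m (m x y) z = m x (m y z)"
proof -
  note D = algebra_onD[OF m]
  let ?p = "pure_tensor sA sB"
  let ?lin = "linear_on_tensor sA sB tensor_scale"
  note p = pure_in_tensor_space[of sA sB]
  have 1: "m (m (?p a b) (?p a' b')) w = m (?p a b) (m (?p a' b') w)"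
    if "w \<in> tensor_space sA sB" for a b a' b' w
    by (rule tensor_universal_unique[OF _ _ _ that, where sC = tensor_scale])
      (auto simp: linear_on_tensor_def D p pure)
  have 2: "m (m (?p a b) w) z = m (?p a b) (m w z)" if "w \<in> tensor_space sA sB" for a b w
    by (rule tensor_universal_unique[OF _ _ _ that, where sC = tensor_scale])
      (auto simp: linear_on_tensor_def D p 1 z)
  show ?thesis
    by (rule tensor_universal_unique[OF _ _ _ x, where sC = tensor_scale])
      (auto simp: linear_on_tensor_def D p 2 y z)
qed

lemma pure_tensor_add_left:
  assumes "vector_space sA" "vector_space sB"
  shows "pure_tensor sA sB (a + a') b = pure_tensor sA sB a b + pure_tensor sA sB a' b"
  using pure_tensor_bilinear[OF assms] by (simp add: bilinear_map_iff assms vector_space_tensor_scale)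

text \<open>Both sides expand to the same sum over the six orderings \<open>i, j, k\<close> of 1, 2,
  3: the terms are \<open>star (star ai aj) ak\<close> tensored with the triple product of the b's
  that ends in \<open>bk\<close>.\<close>

lemma tensor_op_assoc_pure:
  assumes A: "zinbiel_algebra sA UNIV star" and B: "perm_algebra sB UNIV dia"
  defines "m \<equiv> tensor_op sA sB star dia" and "p \<equiv> pure_tensor sA sB"
  shows "m (m (p a1 b1) (p a2 b2)) (p a3 b3) = m (p a1 b1) (m (p a2 b2) (p a3 b3))"
proof -
  have A': "algebra_on sA UNIV star" and B': "algebra_on sB UNIV dia"
    using A B by (auto simp: zinbiel_algebra_def perm_algebra_def)
  then have vs: "vector_space sA" "vector_space sB" by (auto simp: algebra_on_def)
  note D = algebra_onD[OF tensor_op_algebra[OF A' B']]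
  have z: "star x (star y z) = star (star x y) z + star (star y x) z" for x y z
    using A by (simp add: zinbiel_algebra_def)
  have b: "dia x (dia y z) = dia (dia x y) z" "dia (dia x y) z = dia (dia y x) z" for x y z
    using B unfolding perm_algebra_def by blast+
  \<comment> \<open>Once \<open>b(1)\<close> has bracketed everything to the left, these instances
    leave a single normal form for each choice of last factor.\<close>
  have e: "dia (dia b2 b1) b3 = dia (dia b1 b2) b3" "dia (dia b3 b1) b2 = dia (dia b1 b3) b2"
    "dia (dia b3 b2) b1 = dia (dia b2 b3) b1"
    by (rule b(2))+
  show ?thesis
    unfolding m_def p_def
    by (simp add: tensor_op_pure[OF A' B'] D pure_in_tensor_space z b(1) e
        pure_tensor_add_left[OF vs] ac_simps del: plus_fun_apply)
qed

lemma zinbiel_perm_comm_assoc: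
  assumes A: "zinbiel_algebra sA UNIV star" and B: "perm_algebra sB UNIV dia"
  shows "comm_assoc_algebra tensor_scale (tensor_space sA sB) (tensor_op sA sB star dia)"
proof -
  have A': "algebra_on sA UNIV star" and B': "algebra_on sB UNIV dia"
    using A B by (auto simp: zinbiel_algebra_def perm_algebra_def)
  show ?thesis
    unfolding comm_assoc_algebra_def
    using tensor_op_algebra[OF A' B'] tensor_op_commute[OF A' B']
      tensor_assocI[OF tensor_op_algebra[OF A' B'] tensor_op_assoc_pure[OF A B]]
    by blast
qed

section \<open>Direct sum decompositions and their projections\<close>

text \<open>Applying \<open>P i\<close> to any decomposition of \<open>v\<close> leaves only its
  \<open>i\<close>-th term, so that term must be \<open>P i v\<close>; existence is the assumption
  \<open>ex\<close>.\<close>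

lemma direct_sum_decompI:
  assumes "vector_space s"
    and G: "\<And>i. module.subspace s (G i)" "\<And>i. G i \<subseteq> V"
    and P: "\<And>i. module_hom s s (P i)"
    and PG: "\<And>i x. x \<in> G i \<Longrightarrow> P i x = x" "\<And>i j x. x \<in> G j \<Longrightarrow> i \<noteq> j \<Longrightarrow> P i x = 0"
    and ex: "\<And>v. v \<in> V \<Longrightarrow> \<exists>I. finite I \<and> (\<forall>i. P i v \<in> G i) \<and> (\<forall>i. i \<notin> I \<longrightarrow> P i v = 0) \<and>
      v = (\<Sum>i\<in>I. P i v)"
  shows "direct_sum_decomp s V G"
  unfolding direct_sum_decomp_def
proof (intro conjI allI ballI G)
  fix v assume "v \<in> V"
  from ex[OF this] obtain I where I: "finite I" "\<And>i. P i v \<in> G i" "\<And>i. i \<notin> I \<Longrightarrow> P i v = 0"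
    "v = (\<Sum>i\<in>I. P i v)" by blast
  have sub: "{i. P i v \<noteq> 0} \<subseteq> I" using I(3) by blast
  have "v = (\<Sum>i\<in>{i. P i v \<noteq> 0}. P i v)"
    by (rule trans[OF I(4)], rule sum.mono_neutral_right[OF I(1) sub]) simp
  moreover have "finite {i. P i v \<noteq> 0}" using finite_subset[OF sub I(1)] .
  ultimately show "\<exists>!f. (\<forall>i. f i \<in> G i) \<and> finite {i. f i \<noteq> 0} \<and> v = (\<Sum>i\<in>{i. f i \<noteq> 0}. f i)"
  proof (intro ex1I[of _ "\<lambda>i. P i v"] conjI allI I(2))
    fix f assume f: "(\<forall>i. f i \<in> G i) \<and> finite {i. f i \<noteq> 0} \<and> v = (\<Sum>i\<in>{i. f i \<noteq> 0}. f i)"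
    show "f = (\<lambda>i. P i v)"
    proof
      fix i
      have "P i v = (\<Sum>j\<in>{i. f i \<noteq> 0}. P i (f j))"
        using f module_hom.sum[OF P[of i], of f "{i. f i \<noteq> 0}"] by simp
      also have "\<dots> = (\<Sum>j\<in>{i. f i \<noteq> 0}. if j = i then f i else 0)"
        using f PG(1)[of "f i" i] PG(2)[of "f j" j i for j] by (intro sum.cong) auto
      also have "\<dots> = f i" using f by (simp add: sum.delta)
      finally show "f i = P i v" by simp
    qed
  qed
qed

text \<open>Linearity comes from uniqueness: adding or scaling decompositions termwise gives a
  decomposition of the sum or multiple, hence the only one.\<close>

lemma direct_sum_projections:
  fixes s :: "'k::field \<Rightarrow> 'v::ab_group_add \<Rightarrow> 'v"
  assumes vs: "vector_space s" and d: "direct_sum_decomp s UNIV G"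
  obtains p where "\<And>i. Vector_Spaces.linear s s (p i)" "\<And>i v. p i v \<in> G i"
    "\<And>i v. v \<in> G i \<Longrightarrow> p i v = v" "\<And>i j v. v \<in> G j \<Longrightarrow> i \<noteq> j \<Longrightarrow> p i v = 0"
    "\<And>v. finite {i. p i v \<noteq> 0}" "\<And>v. v = (\<Sum>i\<in>{i. p i v \<noteq> 0}. p i v)"
proof -
  interpret vector_space s by fact
  have G: "subspace (G i)" for i using d by (simp add: direct_sum_decomp_def)
  define Q where "Q v f \<longleftrightarrow> (\<forall>i. f i \<in> G i) \<and> finite {i. f i \<noteq> 0} \<and> v = (\<Sum>i\<in>{i. f i \<noteq> 0}. f i)" for v f
  have ex1: "\<exists>!f. Q v f" for v using d by (simp add: direct_sum_decomp_def Q_def)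
  define p where "p i v = (THE f. Q v f) i" for i v
  have Qp: "Q v (\<lambda>i. p i v)" for v using theI'[OF ex1[of v]] by (simp add: p_def)
  have eqI: "p i v = f i" if "Q v f" for v f i using Qp[of v] that ex1[of v] by metis
  \<comment> \<open>Any finite superset of the support may serve as index set. This is needed
    because termwise sums can cancel and so have smaller support than the union.\<close>
  have QI: "Q v f" if "\<And>i. f i \<in> G i" "finite I" "{i. f i \<noteq> 0} \<subseteq> I" "v = (\<Sum>i\<in>I. f i)" for v f I
    using that finite_subset[OF that(3,2)] sum.mono_neutral_left[OF that(2,3), of f] by (simp add: Q_def)
  have Qfin: "finite {i. p i v \<noteq> 0}" and Qsum: "v = (\<Sum>i\<in>{i. p i v \<noteq> 0}. p i v)"
    and QG: "p i v \<in> G i" for i v using Qp[of v] unfolding Q_def by blast+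
  have lin: "Vector_Spaces.linear s s (p i)" for i
    unfolding Vector_Spaces.linear_iff
  proof (intro conjI allI vs)
    fix v w
    let ?I = "{i. p i v \<noteq> 0} \<union> {i. p i w \<noteq> 0}"
    have fin: "finite ?I" using Qfin by simp
    have "v = (\<Sum>i\<in>?I. p i v)"
      by (rule trans[OF Qsum], rule sum.mono_neutral_left[OF fin]) auto
    moreover have "w = (\<Sum>i\<in>?I. p i w)"
      by (rule trans[OF Qsum], rule sum.mono_neutral_left[OF fin]) auto
    ultimately have "v + w = (\<Sum>i\<in>?I. p i v + p i w)" unfolding sum.distrib by argo
    then have "Q (v + w) (\<lambda>i. p i v + p i w)"
      using QG G by (intro QI[OF _ fin]) (auto intro: subspace_add)
    then show "p i (v + w) = p i v + p i w" by (rule eqI)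
  next
    fix c v
    have "Q (s c v) (\<lambda>i. s c (p i v))"
    proof (rule QI)
      show "finite {i. p i v \<noteq> 0}" by (rule Qfin)
      show "s c v = (\<Sum>i\<in>{i. p i v \<noteq> 0}. s c (p i v))"
        unfolding scale_sum_right[symmetric] by (rule arg_cong[OF Qsum])
    qed (use QG G in \<open>auto intro: subspace_scale\<close>)
    then show "p i (s c v) = s c (p i v)" by (rule eqI)
  qed
  have G1: "p i v = (if i = j then v else 0)" if "v \<in> G j" for i j v
    by (rule eqI[where f = "\<lambda>i. if i = j then v else 0"], rule QI[where I = "{j}"])
      (use that G in \<open>auto intro: subspace_0\<close>)
  show ?thesis
    by (rule that[of p, OF lin QG _ _ Qfin Qsum]) (simp_all add: G1)
qed

section \<open>The decomposition of A \<otimes> B\<close>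

text \<open>This is id \<otimes> \<open>p\<close>, the pullback of forms along \<open>p\<close> in
  the second argument. It is set to 0 off the bilinear forms to agree with
  \<open>pure_tensor\<close>.\<close>

definition tensor_map_right ::
    "('k::field \<Rightarrow> 'a::ab_group_add \<Rightarrow> 'a) \<Rightarrow> ('k \<Rightarrow> 'b::ab_group_add \<Rightarrow> 'b) \<Rightarrow>
     ('b \<Rightarrow> 'b) \<Rightarrow> ('a, 'b, 'k) tensor \<Rightarrow> ('a, 'b, 'k) tensor" where
  "tensor_map_right sA sB p x = (\<lambda>\<beta>. if bilinear_map sA sB (*) \<beta> then x (\<lambda>a b. \<beta> a (p b)) else 0)"

lemma module_hom_tensor_map_right:
  "module_hom tensor_scale tensor_scale (tensor_map_right sA sB p)"
  by unfold_locales (auto simp: tensor_map_right_def tensor_scale_def fun_eq_iff)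

lemma tensor_map_right_pure:
  assumes "vector_space sA" "vector_space sB" "Vector_Spaces.linear sB sB p"
  shows "tensor_map_right sA sB p (pure_tensor sA sB a b) = pure_tensor sA sB a (p b)"
proof
  fix \<beta>
  \<comment> \<open>Linearity of \<open>p\<close> enters here: on a pullback that is not bilinear,
    \<open>pure_tensor\<close> would take its default value 0.\<close>
  have "bilinear_map sA sB (*) (\<lambda>a b. \<beta> a (p b))" if "bilinear_map sA sB (*) \<beta>"
    using that assms(3)
    by (simp add: bilinear_map_iff[OF assms(1,2) vector_space_mult] Vector_Spaces.linear_iff)
  then show "tensor_map_right sA sB p (pure_tensor sA sB a b) \<beta> = pure_tensor sA sB a (p b) \<beta>"
    by (simp add: tensor_map_right_def pure_tensor_def)
qed

lemma tensor_direct_sum: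
  fixes sA :: "'k::field \<Rightarrow> 'a::ab_group_add \<Rightarrow> 'a"
  assumes A: "vector_space sA" and B: "vector_space sB" and d: "direct_sum_decomp sB UNIV G"
  shows "direct_sum_decomp tensor_scale (tensor_space sA sB) (\<lambda>i. tensor_sub sA sB (G i))"
proof -
  obtain p where lin: "\<And>i. Vector_Spaces.linear sB sB (p i)" and pG: "\<And>i v. p i v \<in> G i"
    and pid: "\<And>i v. v \<in> G i \<Longrightarrow> p i v = v" and p0: "\<And>i j v. v \<in> G j \<Longrightarrow> i \<noteq> j \<Longrightarrow> p i v = 0"
    and fin: "\<And>v. finite {i. p i v \<noteq> 0}" and sum: "\<And>v. v = (\<Sum>i\<in>{i. p i v \<noteq> 0}. p i v)"
    using direct_sum_projections[OF B d] by blast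
  define P where "P i = tensor_map_right sA sB (p i)" for i
  let ?t = "pure_tensor sA sB" and ?T = "tensor_sub sA sB"
  have Ph: "module_hom tensor_scale tensor_scale (P i)" for i
    unfolding P_def by (rule module_hom_tensor_map_right)
  note Padd = module_hom.add[OF Ph] and Psc = module_hom.scale[OF Ph] and Pzero = module_hom.zero[OF Ph]
  have Pt: "P i (?t a b) = ?t a (p i b)" for i a b
    unfolding P_def by (rule tensor_map_right_pure[OF A B lin])
  have tl: "module_hom sB tensor_scale (?t a)" for a
    using pure_tensor_bilinear[OF A B] unfolding bilinear_map_def
    by (auto dest: Vector_Spaces.linear.axioms(3))
  note t0 = module_hom.zero[OF tl]
  show ?thesis
  proof (rule direct_sum_decompI[where P = P])
    fix i x assume "x \<in> ?T (G i)"
    moreover have "?T (G i) \<subseteq> {x. P i x = x}"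
      by (rule tensor_sub_subset) (auto simp: ts.subspace_def Padd Psc Pzero Pt pid simp del: plus_fun_apply zero_fun_apply)
    ultimately show "P i x = x" by blast
  next
    fix i j x assume "x \<in> ?T (G j)" and ij: "i \<noteq> j"
    moreover have "?T (G j) \<subseteq> {x. P i x = 0}"
      by (rule tensor_sub_subset)
        (auto simp: ts.subspace_def Padd Psc Pzero Pt p0[OF _ ij] t0 simp del: plus_fun_apply zero_fun_apply)
    ultimately show "P i x = 0" by blast
  next
    fix v assume "v \<in> ?T UNIV"
    then show "\<exists>I. finite I \<and> (\<forall>i. P i v \<in> ?T (G i)) \<and> (\<forall>i. i \<notin> I \<longrightarrow> P i v = 0) \<and> v = (\<Sum>i\<in>I. P i v)"
    proof (induction rule: tensor_space_induct)
      case zero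
      show ?case by (rule exI[of _ "{}"]) (simp add: Pzero subspace_tensor_sub ts.subspace_0 del: zero_fun_apply)
    next
      case (step c a b y)
      then obtain I where I: "finite I" "\<And>i. P i y \<in> ?T (G i)" "\<And>i. i \<notin> I \<Longrightarrow> P i y = 0"
        "y = (\<Sum>i\<in>I. P i y)" by blast
      let ?J = "{i. p i b \<noteq> 0}" and ?v = "tensor_scale c (?t a b)"
      have Pv: "P i ?v = tensor_scale c (?t a (p i b))" for i by (simp add: Psc Pt)
      \<comment> \<open>A common finite index set for the new pure tensor and for \<open>y\<close>,
        over which their decompositions can be added termwise.\<close>
      have finJ: "finite (I \<union> ?J)" using I(1) fin by simp
      have "?t a b = ?t a (\<Sum>i\<in>?J. p i b)" by (rule arg_cong[OF sum])
      also have "\<dots> = (\<Sum>i\<in>?J. ?t a (p i b))" by (rule module_hom.sum[OF tl])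
      finally have "?v = (\<Sum>i\<in>?J. P i ?v)" unfolding Pv ts.scale_sum_right[symmetric] by (rule arg_cong)
      also have "\<dots> = (\<Sum>i\<in>I \<union> ?J. P i ?v)"
        by (rule sum.mono_neutral_left[OF finJ]) (auto simp: Pv t0 simp del: zero_fun_apply)
      finally have 1: "?v = (\<Sum>i\<in>I \<union> ?J. P i ?v)" .
      have "(\<Sum>i\<in>I. P i y) = (\<Sum>i\<in>I \<union> ?J. P i y)"
        by (rule sum.mono_neutral_left[OF finJ]) (auto simp: I(3) simp del: zero_fun_apply)
      with I(4) have 2: "y = (\<Sum>i\<in>I \<union> ?J. P i y)" by (rule trans)
      have "?v + y = (\<Sum>i\<in>I \<union> ?J. P i (?v + y))"
        unfolding Padd sum.distrib using 1 2 by argo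
      moreover have "P i (?v + y) \<in> ?T (G i)" for i
        unfolding Padd Pv
        by (intro ts.subspace_add[OF subspace_tensor_sub] ts.subspace_scale[OF subspace_tensor_sub]
            pure_in_tensor_sub pG I(2))
      moreover have "P i (?v + y) = 0" if "i \<notin> I \<union> ?J" for i
        using that I(3) by (simp add: Padd Pv t0 del: zero_fun_apply plus_fun_apply)
      ultimately show ?case using finJ by blast
    qed
  qed (use vector_space_tensor_scale subspace_tensor_sub tensor_sub_le_space Ph in blast)+
qed

section \<open>Compatibility of the product with the grading\<close>

lemma tensor_op_tensor_sub:
  assumes A: "algebra_on sA UNIV star" and B: "algebra_on sB UNIV dia"
    and W: "\<And>x y. x \<in> U \<Longrightarrow> y \<in> V \<Longrightarrow> dia x y \<in> W \<and> dia y x \<in> W"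
    and x: "x \<in> tensor_sub sA sB U" and y: "y \<in> tensor_sub sA sB V"
  shows "tensor_op sA sB star dia x y \<in> tensor_sub sA sB W"
proof -
  let ?m = "tensor_op sA sB star dia" and ?W = "tensor_sub sA sB W" and ?T = "tensor_space sA sB"
  note D = algebra_onD[OF tensor_op_algebra[OF A B]]
  note sub = ts.subspace_0[OF subspace_tensor_sub] ts.subspace_add[OF subspace_tensor_sub]
    ts.subspace_scale[OF subspace_tensor_sub]
  have z: "?m 0 w = 0" "?m w 0 = 0" if "w \<in> ?T" for w
    using D(4)[of 0 w 0, OF sub(1) that] D(5)[of w 0 0, OF that sub(1)] by simp_all
  \<comment> \<open>The sets are intersected with \<open>?T\<close> because \<open>D\<close> gives
    bilinearity of the operation only for arguments in A \<otimes> B.\<close>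
  have 1: "tensor_sub sA sB V \<subseteq> {y \<in> ?T. ?m (pure_tensor sA sB a b) y \<in> ?W}" if "b \<in> U" for a b
  proof (rule tensor_sub_subset)
    show "ts.subspace {y \<in> ?T. ?m (pure_tensor sA sB a b) y \<in> ?W}"
      by (auto simp: ts.subspace_def z D sub pure_in_tensor_space simp del: zero_fun_apply plus_fun_apply)
    show "pure_tensor sA sB a' b' \<in> {y \<in> ?T. ?m (pure_tensor sA sB a b) y \<in> ?W}" if "b' \<in> V" for a' b'
      using W[OF \<open>b \<in> U\<close> that]
      by (auto simp: tensor_op_pure[OF A B] pure_in_tensor_space intro!: sub pure_in_tensor_sub simp del: plus_fun_apply)
  qed
  have yT: "y \<in> ?T" using y tensor_sub_le_space by blast
  have "tensor_sub sA sB U \<subseteq> {x \<in> ?T. ?m x y \<in> ?W}"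
  proof (rule tensor_sub_subset)
    show "ts.subspace {x \<in> ?T. ?m x y \<in> ?W}"
      using yT by (auto simp: ts.subspace_def z D sub simp del: zero_fun_apply plus_fun_apply)
  qed (use 1 y pure_in_tensor_space in blast)
  with x show ?thesis by blast
qed

lemma tensor_grading:
  assumes A: "algebra_on sA UNIV star" and B: "algebra_on sB UNIV dia"
    and G: "grading sB UNIV G dia"
  shows "grading tensor_scale (tensor_space sA sB) (\<lambda>i. tensor_sub sA sB (G i)) (tensor_op sA sB star dia)"
  unfolding grading_def
proof (intro conjI allI ballI)
  show "direct_sum_decomp tensor_scale (tensor_space sA sB) (\<lambda>i. tensor_sub sA sB (G i))"
    using A B G by (intro tensor_direct_sum) (auto simp: algebra_on_def grading_def)
next
  fix i j x y assume "x \<in> tensor_sub sA sB (G i)" "y \<in> tensor_sub sA sB (G j)"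
  then show "tensor_op sA sB star dia x y \<in> tensor_sub sA sB (G (i + j))"
  proof (rule tensor_op_tensor_sub[OF A B, rotated])
    fix u v assume "u \<in> G i" "v \<in> G j"
    \<comment> \<open>The operation involves both orders of the factors; they land in the same
      component since i + j = j + i.\<close>
    then show "dia u v \<in> G (i + j) \<and> dia v u \<in> G (i + j)"
      using G unfolding grading_def by (metis add.commute)
  qed
qed

section \<open>Finite-dimensionality of the components\<close>

text \<open>Pure tensors of generators span A \<otimes> \<open>W\<close>: with one factor fixed, the
  pure tensor is linear in the other, so generators can be replaced by arbitrary elements first in
  \<open>W\<close>, then in A.\<close>

lemma fin_dim_tensor_sub:
  assumes A: "vector_space sA" and B: "vector_space sB"
    and fA: "fin_dim sA UNIV" and fW: "fin_dim sB W"
  shows "fin_dim tensor_scale (tensor_sub sA sB W)"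
proof -
  interpret A: vector_space sA by fact
  interpret B: vector_space sB by fact
  obtain S where S: "finite S" "UNIV = A.span S" using fA by (auto simp: fin_dim_def)
  obtain R where R: "finite R" "W = B.span R" using fW by (auto simp: fin_dim_def)
  let ?t = "pure_tensor sA sB"
  let ?F = "(\<lambda>(a, b). ?t a b) ` (S \<times> R)"
  have tr: "module_hom sB tensor_scale (?t a)" and tl: "module_hom sA tensor_scale (\<lambda>a. ?t a b)" for a b
    using pure_tensor_bilinear[OF A B] unfolding bilinear_map_def
    by (auto dest: Vector_Spaces.linear.axioms(3))
  have 1: "?t a b \<in> ts.span ?F" if "a \<in> S" "b \<in> W" for a b
  proof -
    have "B.subspace {b. ?t a b \<in> ts.span ?F}"
      using module_hom.subspace_vimage[OF tr ts.subspace_span, of a ?F] by (simp add: vimage_def)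
    then have "B.span R \<subseteq> {b. ?t a b \<in> ts.span ?F}"
      using \<open>a \<in> S\<close> by (intro B.span_minimal) (auto intro!: ts.span_base)
    with that R(2) show ?thesis by blast
  qed
  have 2: "?t a b \<in> ts.span ?F" if "b \<in> W" for a b
  proof -
    have "A.subspace {a. ?t a b \<in> ts.span ?F}"
      using module_hom.subspace_vimage[OF tl ts.subspace_span, of b ?F] by (simp add: vimage_def)
    then have "A.span S \<subseteq> {a. ?t a b \<in> ts.span ?F}"
      using 1 that by (intro A.span_minimal) auto
    with S(2) show ?thesis by blast
  qed
  have "?F \<subseteq> tensor_sub sA sB W"
    using R(2) by (auto intro: pure_in_tensor_sub B.span_base)
  then have "ts.span ?F \<subseteq> tensor_sub sA sB W"
    by (rule ts.span_minimal) (rule subspace_tensor_sub)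
  moreover have "tensor_sub sA sB W \<subseteq> ts.span ?F"
    using 2 by (intro tensor_sub_subset ts.subspace_span)
  ultimately have "tensor_sub sA sB W = ts.span ?F" by simp
  moreover have "finite ?F" using S(1) R(1) by simp
  ultimately show ?thesis unfolding fin_dim_def by blast
qed

section \<open>The Zinbiel identity from the Laurent perm algebra\<close>

lemma zinbiel_if_laurent_assoc:
  fixes sA :: "'k::field \<Rightarrow> 'a::ab_group_add \<Rightarrow> 'a"
  assumes A: "algebra_on sA UNIV star"
    and ca: "comm_assoc_algebra tensor_scale (tensor_space sA laurent_scale)
      (tensor_op sA laurent_scale star laurent_mult)"
  shows "zinbiel_algebra sA UNIV star"
  unfolding zinbiel_algebra_def
proof (intro conjI ballI A)
  fix a1 a2 a3 :: 'a
  have B: "algebra_on laurent_scale UNIV (laurent_mult :: 'k laurent_der \<Rightarrow> _)"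
    using laurent_perm_algebra unfolding perm_algebra_def by blast
  have vs: "vector_space sA" using A by (simp add: algebra_on_def)
  interpret A: vector_space sA by fact
  let ?m = "tensor_op sA laurent_scale star laurent_mult"
  let ?t = "pure_tensor sA laurent_scale :: 'a \<Rightarrow> 'k laurent_der \<Rightarrow> _"
  note D = algebra_onD[OF tensor_op_algebra[OF A B]]
  define d1 d2 :: "'k laurent_der" where "d1 = laurent_monom 0 0 1" and "d2 = laurent_monom 0 0 2"
  have as: "?m (?m (?t a1 d1) (?t a2 d1)) (?t a3 d2) = ?m (?t a1 d1) (?m (?t a2 d1) (?t a3 d2))"
    using ca pure_in_tensor_space unfolding comm_assoc_algebra_def by blast
  let ?L = "star (star a1 a2) a3 + star (star a2 a1) a3" and ?R = "star a1 (star a2 a3)"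
  show "?R = ?L"
  proof (rule ccontr)
    assume "?R \<noteq> ?L"
    \<comment> \<open>Tensors are functionals on bilinear forms, so the associativity equation can
      be evaluated at the form \<phi> \<otimes> \<psi>, where \<phi> separates the two sides of the
      identity.\<close>
    then obtain \<phi> where \<phi>: "Vector_Spaces.linear sA (*) \<phi>" "\<phi> (?R - ?L) \<noteq> 0"
      using ex_functional[OF vs, of "?R - ?L"] by auto
    have ph: "\<phi> (u + v) = \<phi> u + \<phi> v" "\<phi> (sA c u) = c * \<phi> u" for u v c
      using \<phi>(1) by (simp_all add: Vector_Spaces.linear_iff)
    \<comment> \<open>the coefficient of \<open>x\<^sub>1\<^sup>2 \<partial>\<^sub>2\<close> in the second tensor factor\<close>
    define \<psi> :: "'k laurent_der \<Rightarrow> 'k" where "\<psi> b = Poly_Mapping.lookup (snd b) (2, 0)" for b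
    define \<beta> where "\<beta> a b = \<phi> a * \<psi> b" for a b
    have bil: "bilinear_map sA laurent_scale (*) \<beta>"
      by (simp add: bilinear_map_iff[OF vs vector_space_laurent vector_space_mult] \<beta>_def \<psi>_def ph
          lookup_add laurent_scale_def lookup_single0_mult ring_distribs mult.left_commute)
    have ev: "?t a b \<beta> = \<phi> a * \<psi> b" for a b
      using bil by (simp add: pure_tensor_def \<beta>_def)
    \<comment> \<open>A product keeps the derivation of its last factor: those ending in
      \<open>d1\<close> have no \<partial>-component with index 2, and the two ending in
      \<open>d2\<close> equal \<open>x\<^sub>1\<^sup>2 \<partial>\<^sub>2\<close>.\<close>
    have \<psi>: "\<psi> (laurent_mult (laurent_mult d1 d1) d2) = 1" "\<psi> (laurent_mult d1 (laurent_mult d1 d2)) = 1"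
      "\<psi> (laurent_mult d2 (laurent_mult d1 d1)) = 0"
      "\<psi> (laurent_mult (laurent_mult d1 d2) d1) = 0" "\<psi> (laurent_mult (laurent_mult d2 d1) d1) = 0"
      "\<psi> (laurent_mult d1 (laurent_mult d2 d1)) = 0"
      by (simp_all add: \<psi>_def d1_def d2_def laurent_mult_def laurent_monom_def mult_single)
    have "\<phi> ?L = \<phi> ?R"
      using fun_cong[OF as, of \<beta>]
      by (simp add: tensor_op_pure[OF A B] D pure_in_tensor_space ev \<psi> ph)
    moreover have "\<phi> (?R - ?L) = \<phi> ?R - \<phi> ?L"
      using Vector_Spaces.linear.axioms(3)[OF \<phi>(1)] by (rule module_hom.diff)
    ultimately show False using \<phi>(2) by simp
  qed
qed

text \<open>The Laurent half speaks of \<open>grading\<close> rather than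
  \<open>Z_graded_comm_assoc_algebra\<close>, since the components of the Laurent perm algebra are
  infinite-dimensional (\<open>laurent_not_fin_dim\<close>).\<close>

theorem proposition3p3:
  fixes sA :: "'k::field_char_0 \<Rightarrow> 'a::ab_group_add \<Rightarrow> 'a"
    and star :: "'a \<Rightarrow> 'a \<Rightarrow> 'a"
    and sB :: "'k \<Rightarrow> 'b::ab_group_add \<Rightarrow> 'b"
    and dia :: "'b \<Rightarrow> 'b \<Rightarrow> 'b"
    and G :: "int \<Rightarrow> 'b set"
  assumes "algebra_on sA UNIV star" and "fin_dim sA UNIV"
  shows "(zinbiel_algebra sA UNIV star \<and> Z_graded_perm_algebra sB UNIV G dia \<longrightarrow>
           Z_graded_comm_assoc_algebra tensor_scale (tensor_space sA sB)
             (\<lambda>i. tensor_sub sA sB (G i)) (tensor_op sA sB star dia))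
       \<and> (comm_assoc_algebra tensor_scale (tensor_space sA laurent_scale)
             (tensor_op sA laurent_scale star laurent_mult)
           \<and> grading tensor_scale (tensor_space sA laurent_scale)
             (\<lambda>i. tensor_sub sA laurent_scale (laurent_component i))
             (tensor_op sA laurent_scale star laurent_mult)
          \<longleftrightarrow> zinbiel_algebra sA UNIV star)"
proof (intro conjI impI iffI)
  assume h: "zinbiel_algebra sA UNIV star \<and> Z_graded_perm_algebra sB UNIV G dia"
  then have B: "perm_algebra sB UNIV dia" "algebra_on sB UNIV dia" "grading sB UNIV G dia"
    "\<And>i. fin_dim sB (G i)"
    by (auto simp: Z_graded_perm_algebra_def perm_algebra_def)
  have vs: "vector_space sA" "vector_space sB" using assms(1) B(2) by (auto simp: algebra_on_def)
  show "Z_graded_comm_assoc_algebra tensor_scale (tensor_space sA sB)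
      (\<lambda>i. tensor_sub sA sB (G i)) (tensor_op sA sB star dia)"
    unfolding Z_graded_comm_assoc_algebra_def
    using zinbiel_perm_comm_assoc[OF _ B(1)] h tensor_grading[OF assms(1) B(2,3)]
      fin_dim_tensor_sub[OF vs assms(2) B(4)] by blast
next
  assume "zinbiel_algebra sA UNIV star"
  then show "comm_assoc_algebra tensor_scale (tensor_space sA laurent_scale)
      (tensor_op sA laurent_scale star laurent_mult)"
    by (rule zinbiel_perm_comm_assoc) (rule laurent_perm_algebra)
next
  show "grading tensor_scale (tensor_space sA laurent_scale)
      (\<lambda>i. tensor_sub sA laurent_scale (laurent_component i))
      (tensor_op sA laurent_scale star laurent_mult)"
    using laurent_perm_algebra laurent_grading
    by (intro tensor_grading[OF assms(1)]) (auto simp: perm_algebra_def)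
qed (use zinbiel_if_laurent_assoc[OF assms(1)] in blast)

end
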